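(* Let $\mathcal{M}=\mathcal{SE}_2(3)\times\mathbb{R}^6\times\mathcal{SE}(3)\times\mathcal{IN}$ with elements $\xi=(\mathbf{T},\boldsymbol{b},\mathbf{S},\mathbf{K})$, and let $\mathbf{G}_{\rm V}=\big(\mathbf{SE}_2(3)\ltimes\mathfrak{se}(3)\big)\times\mathbf{SE}(3)\times\mathbf{IN}$ be the symmetry group of the visual-inertial navigation system, acting on $\mathcal{M}$ by $\phi$, with lift $\Lambda:\mathcal{M}\times\mathbb{L}\to\mathfrak{g}$, where $\phi$ and $\Lambda$ are as defined in the context. Let $H:=(R_H,0,p_H)\in\mathbf{SE}_2(3)$, where $R_H$ is an anti-clockwise rotation about the vertical axis $\boldsymbol{e}_3$ and $p_H\in\mathbb{R}^3$ is a translation. Define the right group action $\alpha(H,\xi):=(H^{-1}\mathbf{T},\boldsymbol{b},\mathbf{S},\mathbf{K})$, which represents a change of reference frame that leaves the direction of gravity unchanged. Then the action $\phi$ and the lift $\Lambda$ are, respectively, compatible and invariant with respect to change of reference; that is, for all such $H$, all $X\in\mathbf{G}_{\rm V}$, $\xi\in\mathcal{M}$ and $u\in\mathbb{L}$, $$\alpha(H,\phi(X,\xi))=\phi(X,\alpha(H,\xi)),\qquad \Lambda(\alpha(H,\xi),u)=\Lambda(\xi,u).$$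
   Context: Notation. $\mathbf{SE}_2(3)$: $5\times5$ matrices $(A,a,b)=\begin{bmatrix}A&a&b\\0&1&0\\0&0&1\end{bmatrix}$, $A\in\mathbf{SO}(3)$, $a,b\in\mathbb{R}^3$. $\mathbf{SE}(3)$: $4\times4$ matrices $(A,a)=\begin{bmatrix}A&a\\0&1\end{bmatrix}$. $\mathbf{IN}$: $3\times3$ matrices $\begin{bmatrix}k_1&0&x\\0&k_2&y\\0&0&1\end{bmatrix}$ with $k_1,k_2>0$ (camera intrinsics without skew, dimension $4$), with Lie algebra $\mathfrak{in}$ of matrices $(\alpha,\beta,\gamma,\delta)^{\wedge}=\begin{bmatrix}\alpha&0&\gamma\\0&\beta&\delta\\0&0&0\end{bmatrix}$. Calligraphic $\mathcal{SE}_2(3),\mathcal{SE}(3),\mathcal{IN}$ denote the underlying manifolds. For $\boldsymbol{\omega}\in\mathbb{R}^3$, $\boldsymbol{\omega}^{\wedge}$ is the skew-symmetric cross-product matrix; $(\boldsymbol{\omega},\boldsymbol{v})^{\wedge}=\begin{bmatrix}\boldsymbol{\omega}^{\wedge}&\boldsymbol{v}\\0&0\end{bmatrix}\in\mathfrak{se}(3)$ and $(\boldsymbol{\omega},\boldsymbol{v},\boldsymbol{p})^{\wedge}=\begin{bmatrix}\boldsymbol{\omega}^{\wedge}&\boldsymbol{v}&\boldsymbol{p}\\0&0&0\\0&0&0\end{bmatrix}\in\mathfrak{se}_2(3)$; $(\cdot)^{\vee}$ is the inverse of $(\cdot)^{\wedge}$. $\mathbf{Ad}^{\vee}_B\boldsymbol{u}=(B\boldsymbol{u}^{\wedge}B^{-1})^{\vee}$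 and $\mathbf{ad}^{\vee}_{\boldsymbol{u}}\boldsymbol{v}=[\boldsymbol{u}^{\wedge},\boldsymbol{v}^{\wedge}]^{\vee}$. $\Pi((\boldsymbol{\omega},\boldsymbol{v},\boldsymbol{p})^{\wedge})=(\boldsymbol{\omega},\boldsymbol{v})^{\wedge}$ and $\Upsilon((\boldsymbol{\omega},\boldsymbol{v},\boldsymbol{p})^{\wedge})=(\boldsymbol{\omega},\boldsymbol{p})^{\wedge}$. System. Inputs are $u=(\boldsymbol{w},\boldsymbol{\tau},\boldsymbol{\mu},\boldsymbol{\zeta})\in\mathbb{L}$ with $\boldsymbol{w}=(\boldsymbol{\omega},\boldsymbol{a})\in\mathbb{R}^6$ (IMU readings), $\boldsymbol{\tau},\boldsymbol{\mu}\in\mathbb{R}^6$, $\boldsymbol{\zeta}\in\mathbb{R}^4$; $\boldsymbol{b}=(\boldsymbol{b}_\omega,\boldsymbol{b}_a)$. The system is $\dot{\mathbf{T}}=\mathbf{T}(\mathbf{W}-\mathbf{B}+\mathbf{N})+(\mathbf{G}-\mathbf{N})\mathbf{T}$, $\dot{\boldsymbol{b}}=\boldsymbol{\tau}$, $\dot{\mathbf{S}}=\mathbf{S}\boldsymbol{\mu}^{\wedge}$, $\dot{\mathbf{K}}=\mathbf{K}\boldsymbol{\zeta}^{\wedge}$, where $\mathbf{W}=(\boldsymbol{\omega},\boldsymbol{a},\mathbf{0})^{\wedge}$, $\mathbf{B}=(\boldsymbol{b}_\omega,\boldsymbol{b}_a,\mathbf{0})^{\wedge}$, $\mathbf{N}\in\mathbb{R}^{5\times5}$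 has a single nonzero entry, $1$, in row $4$, column $5$, and $\mathbf{G}=(\mathbf{0},\boldsymbol{g},\mathbf{0})^{\wedge}$, with gravity vector $\boldsymbol{g}=g\boldsymbol{e}_3$ aligned with the vertical axis $\boldsymbol{e}_3=(0,0,1)^{\top}$. Symmetry. Elements of $\mathbf{G}_{\rm V}$ are $X=((D,\delta),E,L)$ with $D=(A,a,b)\in\mathbf{SE}_2(3)$, $\delta\in\mathfrak{se}(3)$, $E\in\mathbf{SE}(3)$, $L\in\mathbf{IN}$; put $B=(A,a)$, $C=(A,b)\in\mathbf{SE}(3)$. The action is $$\phi(X,\xi)=\big(\mathbf{T}D,\;\mathbf{Ad}^{\vee}_{B^{-1}}(\boldsymbol{b}-\delta^{\vee}),\;C^{-1}\mathbf{S}E,\;\mathbf{K}L\big).$$ The lift is $\Lambda=((\Lambda_1,\Lambda_2),\Lambda_3,\Lambda_4)$ with $$\Lambda_1(\xi,u)=(\mathbf{W}-\mathbf{B}+\mathbf{N})+\mathbf{T}^{-1}(\mathbf{G}-\mathbf{N})\mathbf{T},\qquad \Lambda_2(\xi,u)=\big(\mathbf{ad}^{\vee}_{\boldsymbol{b}}(\Pi(\Lambda_1(\xi,u))^{\vee})-\boldsymbol{\tau}\big)^{\wedge},$$ $$\Lambda_3(\xi,u)=\big(\mathbf{Ad}^{\vee}_{\mathbf{S}^{-1}}(\Upsilon(\Lambda_1(\xi,u))^{\vee})+\boldsymbol{\mu}\big)^{\wedge},\qquad \Lambda_4(\xi,u)=\boldsymbol{\zeta}^{\wedge}.$$ *)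

theory Defs
  imports "HOL-Analysis.Analysis" "HOL-Algebra.Group"
begin

lemma exhaust_5: fixes i :: 5 shows "i = 1 \<or> i = 2 \<or> i = 3 \<or> i = 4 \<or> i = 5"
proof (induct i)
  case (of_int z)
  then have "z = 0 \<or> z = 1 \<or> z = 2 \<or> z = 3 \<or> z = 4" by simp arith
  then show ?case by auto
qed

lemma forall_5: "(\<forall>i::5. P i) \<longleftrightarrow> P 1 \<and> P 2 \<and> P 3 \<and> P 4 \<and> P 5"
  by (metis exhaust_5)

lemma UNIV_5: "(UNIV :: 5 set) = {1, 2, 3, 4, 5}"
  using exhaust_5 by auto

lemma sum_5: "sum f (UNIV::5 set) = f 1 + f 2 + f 3 + f 4 + f 5"
  unfolding UNIV_5 by (simp add: ac_simps)

lemma vector_4 [simp]: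
  "(vector [a, b, c, d] :: 'a::zero^4) $ 1 = a"
  "(vector [a, b, c, d] :: 'a::zero^4) $ 2 = b"
  "(vector [a, b, c, d] :: 'a::zero^4) $ 3 = c"
  "(vector [a, b, c, d] :: 'a::zero^4) $ 4 = d"
  unfolding vector_def by simp_all

lemma vector_5 [simp]:
  "(vector [a, b, c, d, e] :: 'a::zero^5) $ 1 = a"
  "(vector [a, b, c, d, e] :: 'a::zero^5) $ 2 = b"
  "(vector [a, b, c, d, e] :: 'a::zero^5) $ 3 = c"
  "(vector [a, b, c, d, e] :: 'a::zero^5) $ 4 = d"
  "(vector [a, b, c, d, e] :: 'a::zero^5) $ 5 = e"
  unfolding vector_def by simp_all


type_synonym vec3 = "real^3"
type_synonym vec6 = "vec3 \<times> vec3"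
type_synonym mat3 = "real^3^3"
type_synonym mat4 = "real^4^4"
type_synonym mat5 = "real^5^5"

definition block4 :: "mat3 \<Rightarrow> vec3 \<Rightarrow> real \<Rightarrow> mat4" where
  "block4 A a d = vector
    [vector [A$1$1, A$1$2, A$1$3, a$1],
     vector [A$2$1, A$2$2, A$2$3, a$2],
     vector [A$3$1, A$3$2, A$3$3, a$3],
     vector [0,     0,     0,     d]]"

text \<open>The lower right block \<open>U\<close> is \<open>mat 1\<close> on \<open>SE_2(3)\<close>, zero on \<open>se_2(3)\<close>, and
  nilpotent for the matrix \<open>N\<close> of the dynamics, so one multiplication rule serves all of them.\<close>

definition block5 :: "mat3 \<Rightarrow> vec3 \<Rightarrow> vec3 \<Rightarrow> real^2^2 \<Rightarrow> mat5" where
  "block5 A a b U = vector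
    [vector [A$1$1, A$1$2, A$1$3, a$1, b$1],
     vector [A$2$1, A$2$2, A$2$3, a$2, b$2],
     vector [A$3$1, A$3$2, A$3$3, a$3, b$3],
     vector [0,     0,     0,     U$1$1, U$1$2],
     vector [0,     0,     0,     U$2$1, U$2$2]]"

lemma block4_mult:
  "block4 A a d ** block4 A' a' d' = block4 (A ** A') (A *v a' + d' *\<^sub>R a) (d * d')"
  by (simp add: block4_def vec_eq_iff forall_4 sum_4 sum_3 matrix_matrix_mult_def matrix_vector_mult_def)

lemma block5_mult:
  "block5 A a b U ** block5 A' a' b' U' =
     block5 (A ** A') (A *v a' + U'$1$1 *\<^sub>R a + U'$2$1 *\<^sub>R b) (A *v b' + U'$1$2 *\<^sub>R a + U'$2$2 *\<^sub>R b) (U ** U')"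
  by (simp add: block5_def vec_eq_iff forall_5 sum_5 sum_3 sum_2 matrix_matrix_mult_def matrix_vector_mult_def)


definition SE3_mat :: "mat3 \<Rightarrow> vec3 \<Rightarrow> mat4" where
  "SE3_mat A a = block4 A a 1"

definition SE23_mat :: "mat3 \<Rightarrow> vec3 \<Rightarrow> vec3 \<Rightarrow> mat5" where
  "SE23_mat A a b = block5 A a b (mat 1)"

definition IN_mat :: "real \<Rightarrow> real \<Rightarrow> real \<Rightarrow> real \<Rightarrow> mat3" where
  "IN_mat k1 k2 x y = vector [vector [k1, 0, x], vector [0, k2, y], vector [0, 0, 1]]"

definition SE3 :: "mat4 set" where
  "SE3 = {SE3_mat A a | A a. rotation_matrix A}"

definition SE23 :: "mat5 set" where
  "SE23 = {SE23_mat A a b | A a b. rotation_matrix A}"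

definition IN :: "mat3 set" where
  "IN = {IN_mat k1 k2 x y | k1 k2 x y. k1 > 0 \<and> k2 > 0}"

definition hat :: "vec3 \<Rightarrow> mat3" where
  "hat w = matrix (cross3 w)"

definition hat_se3 :: "vec6 \<Rightarrow> mat4" where
  "hat_se3 = (\<lambda>(w, v). block4 (hat w) v 0)"

definition hat_se23 :: "vec3 \<times> vec3 \<times> vec3 \<Rightarrow> mat5" where
  "hat_se23 = (\<lambda>(w, v, p). block5 (hat w) v p 0)"

definition hat_in :: "real^4 \<Rightarrow> mat3" where
  "hat_in z = vector [vector [z$1, 0, z$3], vector [0, z$2, z$4], vector [0, 0, 0]]"

text \<open>Off the Lie algebra the \<open>vee\<close> maps are unspecified; they are only ever applied inside it
  (see \<open>conj_in_se3\<close>, \<open>hat_ad_vee\<close> and \<open>Lambda1_in_se23\<close>).\<close>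

definition vee_se3 :: "mat4 \<Rightarrow> vec6" where
  "vee_se3 = the_inv hat_se3"

definition vee_se23 :: "mat5 \<Rightarrow> vec3 \<times> vec3 \<times> vec3" where
  "vee_se23 = the_inv hat_se23"

definition Ad_vee :: "mat4 \<Rightarrow> vec6 \<Rightarrow> vec6" where
  "Ad_vee B u = vee_se3 (B ** hat_se3 u ** matrix_inv B)"

definition ad_vee :: "vec6 \<Rightarrow> vec6 \<Rightarrow> vec6" where
  "ad_vee u v = vee_se3 (hat_se3 u ** hat_se3 v - hat_se3 v ** hat_se3 u)"

definition Pi_map :: "mat5 \<Rightarrow> mat4" where
  "Pi_map M = (case vee_se23 M of (w, v, p) \<Rightarrow> hat_se3 (w, v))"

definition Upsilon_map :: "mat5 \<Rightarrow> mat4" where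
  "Upsilon_map M = (case vee_se23 M of (w, v, p) \<Rightarrow> hat_se3 (w, p))"


text \<open>For \<open>D = (A, a, b)\<close>: \<open>B = (A, a)\<close> and \<open>C = (A, b)\<close>.\<close>

definition rot_block :: "mat5 \<Rightarrow> mat3" where
  "rot_block D = vector
    [vector [D$1$1, D$1$2, D$1$3], vector [D$2$1, D$2$2, D$2$3], vector [D$3$1, D$3$2, D$3$3]]"

definition B_part :: "mat5 \<Rightarrow> mat4" where
  "B_part D = SE3_mat (rot_block D) (vector [D$1$4, D$2$4, D$3$4])"

definition C_part :: "mat5 \<Rightarrow> mat4" where
  "C_part D = SE3_mat (rot_block D) (vector [D$1$5, D$2$5, D$3$5])"

definition matrix_group :: "(real^'n^'n) set \<Rightarrow> (real^'n^'n) monoid" where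
  "matrix_group S = \<lparr>carrier = S, mult = (**), one = mat 1\<rparr>"

text \<open>In the semidirect product \<open>D = (A, a, b)\<close> acts on \<open>se(3)\<close> by \<open>Ad\<close> of \<open>B = (A, a)\<close>. This is the
  multiplication for which \<open>phi\<close> is a right action (\<open>phi_right_action\<close>).\<close>

definition SE23_semidirect_se3 :: "(mat5 \<times> mat4) monoid" where
  "SE23_semidirect_se3 =
    \<lparr>carrier = SE23 \<times> range hat_se3,
     mult = (\<lambda>(D1, d1) (D2, d2). (D1 ** D2, d1 + B_part D1 ** d2 ** matrix_inv (B_part D1))),
     one = (mat 1, 0)\<rparr>"

type_synonym sym = "(mat5 \<times> mat4) \<times> mat4 \<times> mat3"

definition G_V :: "sym monoid" where
  "G_V = SE23_semidirect_se3 \<times>\<times> matrix_group SE3 \<times>\<times> matrix_group IN"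

definition lie_G_V :: "sym set" where
  "lie_G_V = (range hat_se23 \<times> range hat_se3) \<times> range hat_se3 \<times> range hat_in"


text \<open>States are \<open>(T, b, S, K)\<close>, inputs are \<open>(w, \<tau>, \<mu>, \<zeta>)\<close>. The input space is the whole vector
  space, hence a type and not a set.\<close>

type_synonym state = "mat5 \<times> vec6 \<times> mat4 \<times> mat3"

type_synonym input =
  "vec6 \<times> vec6 \<times> vec6 \<times> (real^4)"

definition state_space :: "state set" where
  "state_space = SE23 \<times> UNIV \<times> SE3 \<times> IN"

fun phi :: "sym \<Rightarrow> state \<Rightarrow> state" where
  "phi ((D, d), E, L) (T, b, S, K) =
    (T ** D,
     Ad_vee (matrix_inv (B_part D)) (b - vee_se3 d),
     matrix_inv (C_part D) ** S ** E,
     K ** L)"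

definition N_mat :: "mat5" where
  "N_mat = (\<chi> i j. if i = 4 \<and> j = 5 then 1 else 0)"

definition e3 :: "vec3" where
  "e3 = vector [0, 0, 1]"

text \<open>\<open>g\<close> is the signed gravity constant; its sign depends on whether the vertical axis points up
  or down, so it is left arbitrary.\<close>

definition G_mat :: "real \<Rightarrow> mat5" where
  "G_mat g = hat_se23 (0, g *\<^sub>R e3, 0)"

fun Lambda1 :: "real \<Rightarrow> state \<Rightarrow> input \<Rightarrow> mat5" where
  "Lambda1 g (T, (b\<^sub>\<omega>, b\<^sub>a), S, K) ((\<omega>, a), \<tau>, \<mu>, \<zeta>) =
    (hat_se23 (\<omega>, a, 0) - hat_se23 (b\<^sub>\<omega>, b\<^sub>a, 0) + N_mat)
      + matrix_inv T ** (G_mat g - N_mat) ** T"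

fun Lambda2 :: "real \<Rightarrow> state \<Rightarrow> input \<Rightarrow> mat4" where
  "Lambda2 g (T, b, S, K) (w, \<tau>, \<mu>, \<zeta>) =
    hat_se3 (ad_vee b (vee_se3 (Pi_map (Lambda1 g (T, b, S, K) (w, \<tau>, \<mu>, \<zeta>)))) - \<tau>)"

fun Lambda3 :: "real \<Rightarrow> state \<Rightarrow> input \<Rightarrow> mat4" where
  "Lambda3 g (T, b, S, K) (w, \<tau>, \<mu>, \<zeta>) =
    hat_se3 (Ad_vee (matrix_inv S)
      (vee_se3 (Upsilon_map (Lambda1 g (T, b, S, K) (w, \<tau>, \<mu>, \<zeta>)))) + \<mu>)"

fun Lambda4 :: "state \<Rightarrow> input \<Rightarrow> mat3" where
  "Lambda4 \<xi> (w, \<tau>, \<mu>, \<zeta>) = hat_in \<zeta>"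

definition lift_V :: "real \<Rightarrow> state \<Rightarrow> input \<Rightarrow> sym" where
  "lift_V g \<xi> u = ((Lambda1 g \<xi> u, Lambda2 g \<xi> u), Lambda3 g \<xi> u, Lambda4 \<xi> u)"


definition rot_e3 :: "real \<Rightarrow> mat3" where
  "rot_e3 \<theta> = vector
    [vector [cos \<theta>, - sin \<theta>, 0], vector [sin \<theta>, cos \<theta>, 0], vector [0, 0, 1]]"

text \<open>All \<open>H = (R, 0, p)\<close> with \<open>R\<close> a rotation about the vertical axis.\<close>

definition reference_changes :: "mat5 set" where
  "reference_changes = {SE23_mat (rot_e3 \<theta>) 0 p | \<theta> p. True}"

fun alpha :: "mat5 \<Rightarrow> state \<Rightarrow> state" where
  "alpha H (T, b, S, K) = (matrix_inv H ** T, b, S, K)"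


lemma hat_expand:
  "hat w = vector [vector [0, - w$3, w$2], vector [w$3, 0, - w$1], vector [- w$2, w$1, 0]]"
  by (simp add: hat_def matrix_def vec_eq_iff forall_3 cross3_def axis_def)

lemma hat_mult_vec: "hat w *v x = cross3 w x"
  by (simp add: hat_expand vec_eq_iff forall_3 cross3_def matrix_vector_mult_def sum_3)

lemma block4_inject: "block4 A a d = block4 A' a' d' \<longleftrightarrow> A = A' \<and> a = a' \<and> d = d'"
  by (auto simp: block4_def vec_eq_iff forall_4 forall_3)

lemma block5_inject: "block5 A a b U = block5 A' a' b' U' \<longleftrightarrow> A = A' \<and> a = a' \<and> b = b' \<and> U = U'"
  by (auto simp: block5_def vec_eq_iff forall_5 forall_3 forall_2)

lemma block4_add: "block4 A a d + block4 A' a' d' = block4 (A + A') (a + a') (d + d')"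
  by (simp add: block4_def vec_eq_iff forall_4)

lemma block4_diff: "block4 A a d - block4 A' a' d' = block4 (A - A') (a - a') (d - d')"
  by (simp add: block4_def vec_eq_iff forall_4)

lemma block5_add: "block5 A a b U + block5 A' a' b' U' = block5 (A + A') (a + a') (b + b') (U + U')"
  by (simp add: block5_def vec_eq_iff forall_5)

lemma block5_diff: "block5 A a b U - block5 A' a' b' U' = block5 (A - A') (a - a') (b - b') (U - U')"
  by (simp add: block5_def vec_eq_iff forall_5)

lemma block4_one: "block4 (mat 1) 0 1 = mat 1"
  by (simp add: block4_def vec_eq_iff forall_4 mat_def)

lemma block5_one: "block5 (mat 1) 0 0 (mat 1) = mat 1"
  by (simp add: block5_def vec_eq_iff forall_5 mat_def)

lemma hat_inject: "hat w = hat w' \<longleftrightarrow> w = w'"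
  by (auto simp: hat_expand vec_eq_iff forall_3)

lemma hat_add: "hat (w + w') = hat w + hat w'"
  by (simp add: hat_expand vec_eq_iff forall_3)

lemma hat_diff: "hat (w - w') = hat w - hat w'"
  by (simp add: hat_expand vec_eq_iff forall_3)

lemma hat_zero: "hat 0 = 0"
  by (simp add: hat_expand vec_eq_iff forall_3)

lemma inj_hat_se3: "inj hat_se3"
  by (auto simp: inj_def hat_se3_def block4_inject hat_inject)

lemma inj_hat_se23: "inj hat_se23"
  by (auto simp: inj_def hat_se23_def block5_inject hat_inject)

lemma vee_hat_se3 [simp]: "vee_se3 (hat_se3 u) = u"
  by (simp add: vee_se3_def the_inv_f_f inj_hat_se3)

lemma vee_hat_se23 [simp]: "vee_se23 (hat_se23 u) = u"
  by (simp add: vee_se23_def the_inv_f_f inj_hat_se23)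

lemma hat_vee_se3: "M \<in> range hat_se3 \<Longrightarrow> hat_se3 (vee_se3 M) = M"
  by auto

lemma Pi_map_hat: "Pi_map (hat_se23 (w, v, p)) = hat_se3 (w, v)"
  by (simp add: Pi_map_def)

lemma Upsilon_map_hat: "Upsilon_map (hat_se23 (w, v, p)) = hat_se3 (w, p)"
  by (simp add: Upsilon_map_def)

lemma hat_se3_add: "hat_se3 (u + v) = hat_se3 u + hat_se3 v"
  by (cases u; cases v) (simp add: hat_se3_def block4_add hat_add)

lemma hat_se3_diff: "hat_se3 (u - v) = hat_se3 u - hat_se3 v"
  by (cases u; cases v) (simp add: hat_se3_def block4_diff hat_diff)

lemma hat_se3_zero: "hat_se3 0 = 0"
  using hat_se3_diff[of 0 0] by simp

lemma matrix_inv_eqI: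
  fixes M M' :: "real^'n^'n"
  assumes "M ** M' = mat 1"
  shows "matrix_inv M = M'"
proof -
  have "M' ** M = mat 1"
    using assms matrix_left_right_inverse by blast
  with assms have "M ** matrix_inv M = mat 1 \<and> matrix_inv M ** M = mat 1"
    unfolding matrix_inv_def
    using someI[of "\<lambda>M'. M ** M' = mat 1 \<and> M' ** M = mat 1" M'] by blast
  then show ?thesis
    using \<open>M' ** M = mat 1\<close> by (metis matrix_mul_assoc matrix_mul_lid matrix_mul_rid)
qed

lemma rotation_matrix_simps:
  assumes "rotation_matrix A"
  shows "A ** transpose A = mat 1" "transpose A ** A = mat 1" "rotation_matrix (transpose A)"
  using assms by (auto simp: rotation_matrix_def orthogonal_matrix_def det_transpose)

lemma rotation_matrix_mult:
  fixes A A' :: "real^'n^'n"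
  shows "rotation_matrix A \<Longrightarrow> rotation_matrix A' \<Longrightarrow> rotation_matrix (A ** A')"
  by (auto simp: rotation_matrix_def det_mul intro: orthogonal_matrix_mul)

lemma rotation_matrix_one: "rotation_matrix (mat 1)"
  by (simp add: rotation_matrix_def orthogonal_matrix_id)

lemma SE3_mat_mult: "SE3_mat A a ** SE3_mat A' a' = SE3_mat (A ** A') (A *v a' + a)"
  by (simp add: SE3_mat_def block4_mult)

lemma SE23_mat_mult:
  "SE23_mat A a b ** SE23_mat A' a' b' = SE23_mat (A ** A') (A *v a' + a) (A *v b' + b)"
  unfolding SE23_mat_def block5_mult matrix_mul_lid by (simp add: mat_def)

lemma SE3_mat_one: "SE3_mat (mat 1) 0 = mat 1"
  by (simp add: SE3_mat_def block4_one)

lemma SE23_mat_one: "SE23_mat (mat 1) 0 0 = mat 1"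
  by (simp add: SE23_mat_def block5_one)

lemma neg_mult_vec: "A *v (- x) = - (A *v (x :: real^'n))"
  by (simp add: matrix_vector_mult_def vec_eq_iff sum_negf)

lemma transpose_cancel:
  assumes "rotation_matrix A"
  shows "A *v (transpose A *v x) = x"
  using rotation_matrix_simps[OF assms]
  by (metis matrix_vector_mul_assoc matrix_vector_mul_lid)

lemma SE3_I: "rotation_matrix A \<Longrightarrow> SE3_mat A a \<in> SE3"
  by (auto simp: SE3_def)

lemma SE3_E:
  assumes "M \<in> SE3" obtains A a where "M = SE3_mat A a" "rotation_matrix A"
  using assms by (auto simp: SE3_def)

lemma SE23_I: "rotation_matrix A \<Longrightarrow> SE23_mat A a b \<in> SE23"
  by (auto simp: SE23_def)

lemma SE23_E:
  assumes "M \<in> SE23" obtains A a b where "M = SE23_mat A a b" "rotation_matrix A"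
  using assms by (auto simp: SE23_def)

lemma SE3_mat_inv:
  assumes "rotation_matrix A"
  shows "SE3_mat A a ** SE3_mat (transpose A) (- (transpose A *v a)) = mat 1"
    "matrix_inv (SE3_mat A a) = SE3_mat (transpose A) (- (transpose A *v a))"
proof -
  show *: "SE3_mat A a ** SE3_mat (transpose A) (- (transpose A *v a)) = mat 1"
    unfolding SE3_mat_mult neg_mult_vec transpose_cancel[OF assms] rotation_matrix_simps[OF assms]
    by (simp add: SE3_mat_one)
  show "matrix_inv (SE3_mat A a) = SE3_mat (transpose A) (- (transpose A *v a))"
    by (rule matrix_inv_eqI[OF *])
qed

lemma SE23_mat_inv:
  assumes "rotation_matrix A"
  shows "SE23_mat A a b ** SE23_mat (transpose A) (- (transpose A *v a)) (- (transpose A *v b)) = mat 1"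
    "matrix_inv (SE23_mat A a b) = SE23_mat (transpose A) (- (transpose A *v a)) (- (transpose A *v b))"
proof -
  show *: "SE23_mat A a b ** SE23_mat (transpose A) (- (transpose A *v a)) (- (transpose A *v b)) = mat 1"
    unfolding SE23_mat_mult neg_mult_vec transpose_cancel[OF assms] rotation_matrix_simps[OF assms]
    by (simp add: SE23_mat_one)
  show "matrix_inv (SE23_mat A a b) = SE23_mat (transpose A) (- (transpose A *v a)) (- (transpose A *v b))"
    by (rule matrix_inv_eqI[OF *])
qed

lemma IN_mat_mult:
  "IN_mat k1 k2 x y ** IN_mat l1 l2 s t = IN_mat (k1 * l1) (k2 * l2) (k1 * s + x) (k2 * t + y)"
  by (simp add: IN_mat_def vec_eq_iff forall_3 matrix_matrix_mult_def sum_3)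

lemma IN_mat_one: "IN_mat 1 1 0 0 = mat 1"
  by (simp add: IN_mat_def vec_eq_iff forall_3 mat_def)

lemma matrix_group_simps [simp]:
  "carrier (matrix_group S) = S" "mult (matrix_group S) = (**)" "one (matrix_group S) = mat 1"
  by (simp_all add: matrix_group_def)

lemma group_matrix_groupI:
  assumes "mat 1 \<in> S" "\<And>M M'. M \<in> S \<Longrightarrow> M' \<in> S \<Longrightarrow> M ** M' \<in> S"
    and "\<And>M. M \<in> S \<Longrightarrow> \<exists>M'\<in>S. M ** M' = mat 1"
  shows "group (matrix_group S)"
proof (rule groupI)
  fix M assume "M \<in> carrier (matrix_group S)"
  with assms(3) obtain M' where "M' \<in> S" "M ** M' = mat 1" by auto
  then show "\<exists>M'\<in>carrier (matrix_group S). M' \<otimes>\<^bsub>matrix_group S\<^esub> M = \<one>\<^bsub>matrix_group S\<^esub>"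
    using matrix_left_right_inverse by auto
qed (use assms in \<open>auto simp: matrix_mul_assoc\<close>)

lemma SE3_mult: "M \<in> SE3 \<Longrightarrow> M' \<in> SE3 \<Longrightarrow> M ** M' \<in> SE3"
  by (elim SE3_E) (simp only: SE3_mat_mult SE3_I rotation_matrix_mult)

lemma SE3_one: "mat 1 \<in> SE3"
  using SE3_I[OF rotation_matrix_one] SE3_mat_one by metis

lemma SE3_inv:
  assumes "M \<in> SE3"
  shows "M ** matrix_inv M = mat 1" "matrix_inv M ** M = mat 1" "matrix_inv M \<in> SE3"
proof -
  show 1: "M ** matrix_inv M = mat 1"
    using assms by (elim SE3_E) (simp only: SE3_mat_inv)
  then show "matrix_inv M ** M = mat 1" using matrix_left_right_inverse by blast
  show "matrix_inv M \<in> SE3"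
    using assms by (elim SE3_E) (simp only: SE3_mat_inv(2) SE3_I rotation_matrix_simps(3))
qed

lemma group_SE3: "group (matrix_group SE3)"
  by (rule group_matrix_groupI[OF SE3_one SE3_mult]) (use SE3_inv in blast)+

lemma SE23_mult: "M \<in> SE23 \<Longrightarrow> M' \<in> SE23 \<Longrightarrow> M ** M' \<in> SE23"
  by (elim SE23_E) (simp only: SE23_mat_mult SE23_I rotation_matrix_mult)

lemma SE23_one: "mat 1 \<in> SE23"
  using SE23_I[OF rotation_matrix_one] SE23_mat_one by metis

lemma SE23_inv:
  assumes "M \<in> SE23"
  shows "M ** matrix_inv M = mat 1" "matrix_inv M ** M = mat 1" "matrix_inv M \<in> SE23"
proof -
  show 1: "M ** matrix_inv M = mat 1"
    using assms by (elim SE23_E) (simp only: SE23_mat_inv)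
  then show "matrix_inv M ** M = mat 1" using matrix_left_right_inverse by blast
  show "matrix_inv M \<in> SE23"
    using assms by (elim SE23_E) (simp only: SE23_mat_inv(2) SE23_I rotation_matrix_simps(3))
qed

lemma group_SE23: "group (matrix_group SE23)"
  by (rule group_matrix_groupI[OF SE23_one SE23_mult]) (use SE23_inv in blast)+

lemma group_IN: "group (matrix_group IN)"
proof (rule group_matrix_groupI)
  show "mat 1 \<in> IN"
    unfolding IN_def using IN_mat_one zero_less_one by (metis (mono_tags, lifting) mem_Collect_eq)
  show "M ** M' \<in> IN" if "M \<in> IN" "M' \<in> IN" for M M'
    using that unfolding IN_def by (auto simp: IN_mat_mult) (metis mult_pos_pos)
  show "\<exists>M'\<in>IN. M ** M' = mat 1" if M: "M \<in> IN" for M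
  proof -
    from M obtain k1 k2 x y where k: "k1 > 0" "k2 > 0" "M = IN_mat k1 k2 x y"
      unfolding IN_def by auto
    then have "M ** IN_mat (1/k1) (1/k2) (-x/k1) (-y/k2) = mat 1"
      by (simp add: IN_mat_mult IN_mat_one)
    moreover have "IN_mat (1/k1) (1/k2) (-x/k1) (-y/k2) \<in> IN"
      using k unfolding IN_def by auto (metis zero_less_divide_1_iff)
    ultimately show ?thesis by blast
  qed
qed

lemma IN_mult: "M \<in> IN \<Longrightarrow> M' \<in> IN \<Longrightarrow> M ** M' \<in> IN"
  using group.subgroup_self[OF group_IN] subgroup.m_closed by fastforce

lemma matrix_inv_mult:
  fixes M M' :: "real^'n^'n"
  assumes "M ** matrix_inv M = mat 1" "M' ** matrix_inv M' = mat 1"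
  shows "matrix_inv (M ** M') = matrix_inv M' ** matrix_inv M"
proof (rule matrix_inv_eqI)
  have "M ** M' ** (matrix_inv M' ** matrix_inv M) = M ** (M' ** matrix_inv M') ** matrix_inv M"
    by (simp only: matrix_mul_assoc)
  then show "M ** M' ** (matrix_inv M' ** matrix_inv M) = mat 1"
    using assms by simp
qed

lemma SE3_inv_mult: "M \<in> SE3 \<Longrightarrow> M' \<in> SE3 \<Longrightarrow> matrix_inv (M ** M') = matrix_inv M' ** matrix_inv M"
  by (intro matrix_inv_mult SE3_inv)

lemma SE23_inv_mult: "M \<in> SE23 \<Longrightarrow> M' \<in> SE23 \<Longrightarrow> matrix_inv (M ** M') = matrix_inv M' ** matrix_inv M"
  by (intro matrix_inv_mult SE23_inv)

lemma SE3_inv_inv: "M \<in> SE3 \<Longrightarrow> matrix_inv (matrix_inv M) = M"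
  by (rule matrix_inv_eqI) (rule SE3_inv)

lemma rot_block_SE23_mat: "rot_block (SE23_mat A a b) = A"
  by (simp add: rot_block_def SE23_mat_def block5_def vec_eq_iff forall_3)

lemma vec3_eta: "vector [x$1, x$2, x$3] = (x :: 'a::zero^3)"
  by (simp add: vec_eq_iff forall_3)

lemma B_part_SE23_mat [simp]: "B_part (SE23_mat A a b) = SE3_mat A a"
  unfolding B_part_def rot_block_SE23_mat
  by (simp add: SE23_mat_def block5_def vec3_eta)

lemma C_part_SE23_mat [simp]: "C_part (SE23_mat A a b) = SE3_mat A b"
  unfolding C_part_def rot_block_SE23_mat
  by (simp add: SE23_mat_def block5_def vec3_eta)

lemma parts_in_SE3: "D \<in> SE23 \<Longrightarrow> B_part D \<in> SE3" "D \<in> SE23 \<Longrightarrow> C_part D \<in> SE3"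
  by (auto elim!: SE23_E intro: SE3_I)

lemma parts_mult:
  assumes "D \<in> SE23" "D' \<in> SE23"
  shows "B_part (D ** D') = B_part D ** B_part D'" "C_part (D ** D') = C_part D ** C_part D'"
  using assms by (auto simp: SE23_def SE23_mat_mult SE3_mat_mult)

lemma parts_one: "B_part (mat 1) = mat 1" "C_part (mat 1) = mat 1"
  using B_part_SE23_mat[of "mat 1" 0 0] C_part_SE23_mat[of "mat 1" 0 0]
  by (simp_all add: SE23_mat_one SE3_mat_one)

lemma hat_conj:
  assumes "rotation_matrix A"
  shows "A ** hat w ** transpose A = hat (A *v w)"
proof -
  have "(A ** hat w ** transpose A) *v x = hat (A *v w) *v x" for x
  proof -
    have "(A ** hat w ** transpose A) *v x = A *v (cross3 w (transpose A *v x))"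
      unfolding hat_mult_vec[symmetric] by (simp only: matrix_vector_mul_assoc matrix_mul_assoc)
    also have "\<dots> = cross3 (A *v w) (A *v (transpose A *v x))"
      using cross_rotation_matrix[OF assms] by simp
    finally show ?thesis
      unfolding hat_mult_vec transpose_cancel[OF assms] .
  qed
  then show ?thesis by (simp add: matrix_eq)
qed

lemma conj_in_se3:
  assumes "M \<in> SE3" "d \<in> range hat_se3"
  shows "M ** d ** matrix_inv M \<in> range hat_se3"
proof -
  from assms obtain A a w v where *: "M = SE3_mat A a" "rotation_matrix A" "d = hat_se3 (w, v)"
    unfolding SE3_def by auto
  have "M ** d ** matrix_inv M =
      block4 (A ** hat w ** transpose A) ((A ** hat w) *v (- (transpose A *v a)) + A *v v) 0"
    unfolding *(1,3) SE3_mat_inv(2)[OF *(2)] by (simp add: SE3_mat_def hat_se3_def block4_mult)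
  also have "\<dots> = hat_se3 (A *v w, (A ** hat w) *v (- (transpose A *v a)) + A *v v)"
    by (simp only: hat_se3_def hat_conj[OF *(2)] prod.case)
  finally show ?thesis by simp
qed

lemma hat_Ad_vee: "M \<in> SE3 \<Longrightarrow> hat_se3 (Ad_vee M u) = M ** hat_se3 u ** matrix_inv M"
  by (simp add: Ad_vee_def hat_vee_se3 conj_in_se3)

lemma hat_ad_vee: "hat_se3 (ad_vee u v) = hat_se3 u ** hat_se3 v - hat_se3 v ** hat_se3 u"
proof -
  obtain w1 v1 w2 v2 where uv: "u = (w1, v1)" "v = (w2, v2)" by (cases u; cases v)
  have "hat w1 ** hat w2 - hat w2 ** hat w1 = hat (cross3 w1 w2)"
    by (simp add: hat_expand vec_eq_iff forall_3 cross3_def matrix_matrix_mult_def sum_3)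
  then have "hat_se3 u ** hat_se3 v - hat_se3 v ** hat_se3 u
      = hat_se3 (cross3 w1 w2, hat w1 *v v2 - hat w2 *v v1)"
    by (simp add: uv hat_se3_def block4_mult block4_diff)
  then show ?thesis by (simp add: ad_vee_def)
qed

lemma se3_add: "d \<in> range hat_se3 \<Longrightarrow> d' \<in> range hat_se3 \<Longrightarrow> d + d' \<in> range hat_se3"
  by (auto simp: hat_se3_add[symmetric])

lemma se3_minus: "d \<in> range hat_se3 \<Longrightarrow> - d \<in> range hat_se3"
  using hat_se3_diff[of 0] by (auto simp: hat_se3_zero) (metis rangeI)

lemma matrix_distribs:
  fixes X Y Z :: "real^'n^'n"
  shows "(X + Y) ** Z = X ** Z + Y ** Z" "Z ** (X + Y) = Z ** X + Z ** Y"
    "(X - Y) ** Z = X ** Z - Y ** Z" "Z ** (X - Y) = Z ** X - Z ** Y"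
  by (simp_all add: matrix_matrix_mult_def vec_eq_iff sum.distrib sum_subtractf algebra_simps)

lemma group_SE23_semidirect_se3: "group SE23_semidirect_se3"
proof (rule groupI)
  fix x assume "x \<in> carrier SE23_semidirect_se3"
  then obtain D d where x: "x = (D, d)" "D \<in> SE23" "d \<in> range hat_se3"
    by (auto simp: SE23_semidirect_se3_def)
  let ?D = "matrix_inv D"
  let ?d = "- (B_part ?D ** d ** matrix_inv (B_part ?D))"
  have "?D \<in> SE23" "?d \<in> range hat_se3"
    using x SE23_inv(3) parts_in_SE3 conj_in_se3 se3_minus by blast+
  then show "\<exists>y\<in>carrier SE23_semidirect_se3. y \<otimes>\<^bsub>SE23_semidirect_se3\<^esub> x = \<one>\<^bsub>SE23_semidirect_se3\<^esub>"
    using x by (intro bexI[of _ "(?D, ?d)"]) (simp_all add: SE23_semidirect_se3_def SE23_inv)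
next
  fix x y z
  assume "x \<in> carrier SE23_semidirect_se3" "y \<in> carrier SE23_semidirect_se3"
    "z \<in> carrier SE23_semidirect_se3"
  then show "x \<otimes>\<^bsub>SE23_semidirect_se3\<^esub> y \<otimes>\<^bsub>SE23_semidirect_se3\<^esub> z =
      x \<otimes>\<^bsub>SE23_semidirect_se3\<^esub> (y \<otimes>\<^bsub>SE23_semidirect_se3\<^esub> z)"
    by (auto simp: SE23_semidirect_se3_def parts_mult SE3_inv_mult parts_in_SE3 matrix_mul_assoc
        matrix_distribs add.assoc)
next
  have [simp]: "matrix_inv (mat 1 :: real^4^4) = mat 1" by (rule matrix_inv_eqI) simp
  fix x assume "x \<in> carrier SE23_semidirect_se3"
  then show "\<one>\<^bsub>SE23_semidirect_se3\<^esub> \<otimes>\<^bsub>SE23_semidirect_se3\<^esub> x = x"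
    by (auto simp: SE23_semidirect_se3_def parts_one)
next
  show "\<one>\<^bsub>SE23_semidirect_se3\<^esub> \<in> carrier SE23_semidirect_se3"
    using group.is_monoid[OF group_SE23] monoid.one_closed[of "matrix_group SE23"]
    by (auto simp: SE23_semidirect_se3_def hat_se3_zero[symmetric])
next
  fix x y assume "x \<in> carrier SE23_semidirect_se3" "y \<in> carrier SE23_semidirect_se3"
  moreover have "d + B_part D ** d' ** matrix_inv (B_part D) \<in> range hat_se3"
    if "D \<in> SE23" "d \<in> range hat_se3" "d' \<in> range hat_se3" for D d d'
    using that by (intro se3_add conj_in_se3 parts_in_SE3)
  ultimately show "x \<otimes>\<^bsub>SE23_semidirect_se3\<^esub> y \<in> carrier SE23_semidirect_se3"
    by (auto simp: SE23_semidirect_se3_def intro: SE23_mult)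
qed

lemma group_G_V: "group G_V"
  unfolding G_V_def
  by (intro DirProd_group group_SE23_semidirect_se3 group_SE3 group_IN)

definition right_action :: "'g monoid \<Rightarrow> 's set \<Rightarrow> ('g \<Rightarrow> 's \<Rightarrow> 's) \<Rightarrow> bool" where
  "right_action G M f \<longleftrightarrow> group G \<and> (\<forall>X\<in>carrier G. \<forall>\<xi>\<in>M. f X \<xi> \<in> M)
     \<and> (\<forall>\<xi>\<in>M. f \<one>\<^bsub>G\<^esub> \<xi> = \<xi>)
     \<and> (\<forall>X\<in>carrier G. \<forall>Y\<in>carrier G. \<forall>\<xi>\<in>M. f Y (f X \<xi>) = f (X \<otimes>\<^bsub>G\<^esub> Y) \<xi>)"

lemma Ad_vee_action:
  assumes "M \<in> SE3" "M' \<in> SE3" "d \<in> range hat_se3" "d' \<in> range hat_se3"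
  shows "Ad_vee (matrix_inv M') (Ad_vee (matrix_inv M) (b - vee_se3 d) - vee_se3 d')
    = Ad_vee (matrix_inv (M ** M')) (b - vee_se3 (d + M ** d' ** matrix_inv M))" (is "?l = ?r")
proof -
  let ?m = "matrix_inv M" and ?m' = "matrix_inv M'"
  have c: "d + M ** d' ** ?m \<in> range hat_se3" using assms by (intro se3_add conj_in_se3)
  have k: "?m ** (M ** d' ** ?m) ** M = d'"
  proof -
    have "?m ** (M ** d' ** ?m) ** M = (?m ** M) ** d' ** (?m ** M)" by (simp only: matrix_mul_assoc)
    then show ?thesis using assms by (simp add: SE3_inv)
  qed
  have "hat_se3 ?l = ?m' ** (?m ** (hat_se3 b - d) ** M - d') ** M'"
    using assms by (simp add: hat_Ad_vee SE3_inv hat_se3_diff hat_vee_se3 SE3_inv_inv)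
  also have "\<dots> = ?m' ** (?m ** (hat_se3 b - d) ** M - ?m ** (M ** d' ** ?m) ** M) ** M'"
    by (simp only: k)
  also have "\<dots> = ?m' ** ?m ** (hat_se3 b - (d + M ** d' ** ?m)) ** (M ** M')"
    by (simp only: matrix_distribs matrix_mul_assoc diff_diff_add)
  also have "\<dots> = hat_se3 ?r"
    using assms c by (simp add: hat_Ad_vee SE3_inv SE3_mult hat_se3_diff hat_vee_se3 SE3_inv_inv SE3_inv_mult)
  finally show ?thesis using inj_hat_se3 by (simp add: inj_eq)
qed

lemma phi_right_action: "right_action G_V state_space phi"
  unfolding right_action_def
proof (intro conjI ballI)
  have [simp]: "matrix_inv (mat 1 :: real^4^4) = mat 1" by (rule matrix_inv_eqI) simp
  have [simp]: "vee_se3 0 = 0" using vee_hat_se3[of 0] by (simp add: hat_se3_zero)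
  have [simp]: "Ad_vee (mat 1) b = b" for b by (simp add: Ad_vee_def)
  show "group G_V" by (rule group_G_V)
  show "phi \<one>\<^bsub>G_V\<^esub> \<xi> = \<xi>" for \<xi>
    by (cases \<xi>) (simp add: G_V_def SE23_semidirect_se3_def parts_one)
next
  fix X \<xi> assume "X \<in> carrier G_V" "\<xi> \<in> state_space"
  then show "phi X \<xi> \<in> state_space"
    by (auto simp: G_V_def SE23_semidirect_se3_def state_space_def
        intro!: SE23_mult SE3_mult IN_mult SE3_inv parts_in_SE3)
next
  fix X Y \<xi> assume *: "X \<in> carrier G_V" "Y \<in> carrier G_V" "\<xi> \<in> state_space"
  obtain D d E L D' d' E' L' T b S K
    where XY: "X = ((D, d), E, L)" "Y = ((D', d'), E', L')" "\<xi> = (T, b, S, K)"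
    by (metis surj_pair)
  with * have D: "D \<in> SE23" "D' \<in> SE23" "d \<in> range hat_se3" "d' \<in> range hat_se3"
    by (auto simp: G_V_def SE23_semidirect_se3_def)
  show "phi Y (phi X \<xi>) = phi (X \<otimes>\<^bsub>G_V\<^esub> Y) \<xi>"
    using D by (simp add: XY G_V_def SE23_semidirect_se3_def Ad_vee_action parts_in_SE3 parts_mult
        SE3_inv_mult matrix_mul_assoc)
qed

lemma rotation_matrix_rot_e3: "rotation_matrix (rot_e3 \<theta>)"
  by (simp add: rotation_matrix_def orthogonal_matrix rot_e3_def det_3 transpose_def
      matrix_matrix_mult_def sum_3 vec_eq_iff forall_3 mat_def flip: power2_eq_square)

lemma rot_e3_add: "rot_e3 \<theta> ** rot_e3 \<theta>' = rot_e3 (\<theta> + \<theta>')"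
  by (simp add: rot_e3_def matrix_matrix_mult_def sum_3 vec_eq_iff forall_3 sin_add cos_add)

lemma reference_changes_subset: "reference_changes \<subseteq> SE23"
  by (auto simp: reference_changes_def intro: SE23_I rotation_matrix_rot_e3)

lemma group_reference_changes: "group (matrix_group reference_changes)"
proof (rule group_matrix_groupI)
  have I: "SE23_mat (rot_e3 \<theta>) 0 p \<in> reference_changes" for \<theta> p
    by (auto simp: reference_changes_def)
  have one: "rot_e3 0 = mat 1"
    by (simp add: rot_e3_def vec_eq_iff forall_3 mat_def)
  show "mat 1 \<in> reference_changes"
    using I[of 0 0] by (simp add: one SE23_mat_one)
  show "M ** M' \<in> reference_changes" if M: "M \<in> reference_changes" "M' \<in> reference_changes" for M M'
  proof -
    obtain \<theta> p \<theta>' p' where "M = SE23_mat (rot_e3 \<theta>) 0 p" "M' = SE23_mat (rot_e3 \<theta>') 0 p'"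
      using M by (auto simp: reference_changes_def)
    then have "M ** M' = SE23_mat (rot_e3 (\<theta> + \<theta>')) 0 (rot_e3 \<theta> *v p' + p)"
      by (simp add: SE23_mat_mult rot_e3_add)
    then show ?thesis using I by simp
  qed
  show "\<exists>M'\<in>reference_changes. M ** M' = mat 1" if M: "M \<in> reference_changes" for M
  proof -
    obtain \<theta> p where "M = SE23_mat (rot_e3 \<theta>) 0 p"
      using M by (auto simp: reference_changes_def)
    then have "M ** SE23_mat (rot_e3 (- \<theta>)) 0 (- (rot_e3 (- \<theta>) *v p)) = mat 1"
      by (simp add: SE23_mat_mult rot_e3_add neg_mult_vec matrix_vector_mul_assoc one SE23_mat_one)
    then show ?thesis using I by blast
  qed
qed

lemma alpha_right_action: "right_action (matrix_group reference_changes) state_space alpha"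
  unfolding right_action_def
proof (intro conjI ballI)
  have [simp]: "matrix_inv (mat 1 :: real^5^5) = mat 1" by (rule matrix_inv_eqI) simp
  show "group (matrix_group reference_changes)" by (rule group_reference_changes)
  show "alpha \<one>\<^bsub>matrix_group reference_changes\<^esub> \<xi> = \<xi>" for \<xi>
    by (cases \<xi>) simp
next
  fix H \<xi> assume "H \<in> carrier (matrix_group reference_changes)" "\<xi> \<in> state_space"
  then show "alpha H \<xi> \<in> state_space"
    using reference_changes_subset by (auto simp: state_space_def intro!: SE23_mult SE23_inv)
next
  fix H H' \<xi>
  assume "H \<in> carrier (matrix_group reference_changes)" "H' \<in> carrier (matrix_group reference_changes)"
  then have "H \<in> SE23" "H' \<in> SE23" using reference_changes_subset by auto
  then show "alpha H' (alpha H \<xi>) = alpha (H \<otimes>\<^bsub>matrix_group reference_changes\<^esub> H') \<xi>"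
    by (cases \<xi>) (simp add: SE23_inv_mult matrix_mul_assoc)
qed

lemma N_mat_block: "N_mat = block5 0 0 0 (vector [vector [0, 1], vector [0, 0]])"
  by (simp add: N_mat_def block5_def vec_eq_iff forall_5)

lemma Lambda1_in_se23:
  assumes "T \<in> SE23"
  shows "Lambda1 g (T, b, S, K) u \<in> range hat_se23"
proof -
  obtain A v p where T: "T = SE23_mat A v p" "rotation_matrix A"
    using assms by (rule SE23_E)
  obtain b\<^sub>\<omega> b\<^sub>a \<omega> a \<tau> \<mu> \<zeta> where bu: "b = (b\<^sub>\<omega>, b\<^sub>a)" "u = ((\<omega>, a), \<tau>, \<mu>, \<zeta>)"
    by (metis surj_pair)
  let ?U = "vector [vector [0, 1], vector [0, 0]] :: real^2^2"
  have "\<exists>x y. matrix_inv T ** (G_mat g - N_mat) ** T = block5 0 x y (0 - ?U)"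
    unfolding T(1) SE23_mat_inv(2)[OF T(2)]
    unfolding SE23_mat_def G_mat_def N_mat_block hat_se23_def prod.case block5_diff block5_mult
    by (simp add: hat_zero block5_inject)
  then obtain x y where "matrix_inv T ** (G_mat g - N_mat) ** T = block5 0 x y (0 - ?U)"
    by blast
  then have "Lambda1 g (T, b, S, K) u = hat_se23 (\<omega> - b\<^sub>\<omega>, a - b\<^sub>a + x, y)"
    by (simp add: bu hat_se23_def N_mat_block block5_add block5_diff hat_diff)
  then show ?thesis by simp
qed

lemma lift_V_in_lie_G_V:
  assumes "\<xi> \<in> state_space"
  shows "lift_V g \<xi> u \<in> lie_G_V"
proof -
  obtain T b S K w \<tau> \<mu> \<zeta> where "\<xi> = (T, b, S, K)" "u = (w, \<tau>, \<mu>, \<zeta>)"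
    by (metis surj_pair)
  with assms show ?thesis
    by (simp add: state_space_def lift_V_def lie_G_V_def Lambda1_in_se23)
qed

end

theory Submission
  imports Defs
begin

text \<open>A change of reference \<open>H = (R, 0, p)\<close> with \<open>R\<close> a rotation about the vertical commutes with
  \<open>G - N\<close>: it fixes gravity, and having no velocity component it is not seen by \<open>N\<close>. Hence \<open>H\<close>
  cancels from \<open>T\<inverse> (G - N) T\<close>, the only place where \<open>T\<close> enters the lift. Compatibility of the
  action holds because \<open>H\<close> and \<open>D\<close> act on \<open>T\<close> from opposite sides.\<close>

lemma reference_change_commute:
  assumes "H \<in> reference_changes"
  shows "H ** (G_mat g - N_mat) = (G_mat g - N_mat) ** H"
proof -
  obtain \<theta> p where H: "H = SE23_mat (rot_e3 \<theta>) 0 p"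
    using assms by (auto simp: reference_changes_def)
  have "rot_e3 \<theta> *v (g *\<^sub>R e3) = g *\<^sub>R e3"
    by (simp add: rot_e3_def e3_def matrix_vector_mult_def sum_3 vec_eq_iff forall_3)
  \<comment> \<open>Both products have blocks \<open>0\<close>, \<open>g *\<^sub>R e3\<close>,
    \<open>0\<close>. In \<open>H ** (G_mat g - N_mat)\<close> the entry of \<open>N_mat\<close>
    sends minus the velocity column of \<open>H\<close> to the position column; it vanishes as that
    column is zero.\<close>
  then show ?thesis
    unfolding H SE23_mat_def G_mat_def hat_se23_def N_mat_block prod.case block5_diff block5_mult
      matrix_mul_lid matrix_mul_rid
    by (simp add: hat_zero mat_def)
qed

lemma Lambda1_alpha:
  assumes "H \<in> reference_changes" "T \<in> SE23"
  shows "Lambda1 g (alpha H (T, b, S, K)) u = Lambda1 g (T, b, S, K) u"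
proof -
  have H: "H \<in> SE23" using assms(1) reference_changes_subset by blast
  let ?F = "G_mat g - N_mat"
  \<comment> \<open>Inverting \<open>matrix_inv H ** T\<close> then puts \<open>H\<close> itself to
    the left of \<open>?F\<close>, ready to be commuted past it.\<close>
  have "matrix_inv (matrix_inv H) = H" using H by (intro matrix_inv_eqI SE23_inv(2))
  with assms(2) H have "matrix_inv (matrix_inv H ** T) ** ?F ** (matrix_inv H ** T)
      = matrix_inv T ** (H ** ?F) ** matrix_inv H ** T"
    by (simp add: SE23_inv SE23_inv_mult matrix_mul_assoc)
  also have "\<dots> = matrix_inv T ** ?F ** (H ** matrix_inv H) ** T"
    by (simp only: reference_change_commute[OF assms(1)] matrix_mul_assoc)
  finally have "matrix_inv (matrix_inv H ** T) ** ?F ** (matrix_inv H ** T)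
      = matrix_inv T ** ?F ** T"
    using H by (simp add: SE23_inv)
  then show ?thesis
    by (cases b; cases u) (auto split: prod.splits)
qed

theorem theorem7p3p1:
  fixes g :: real and H :: mat5 and X :: sym and \<xi> :: state and u :: input
  assumes "H \<in> reference_changes"
    and "X \<in> carrier G_V"
    and "\<xi> \<in> state_space"
  shows "alpha H (phi X \<xi>) = phi X (alpha H \<xi>) \<and> lift_V g (alpha H \<xi>) u = lift_V g \<xi> u"
proof
  obtain D d E L T b S K w \<tau> \<mu> \<zeta>
    where X: "X = ((D, d), E, L)" and \<xi>: "\<xi> = (T, b, S, K)" and u: "u = (w, \<tau>, \<mu>, \<zeta>)"
    by (metis surj_pair)
  show "alpha H (phi X \<xi>) = phi X (alpha H \<xi>)"
    by (simp add: X \<xi> matrix_mul_assoc)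
  have "T \<in> SE23" using assms(3) by (simp add: \<xi> state_space_def)
  \<comment> \<open>\<open>Lambda2\<close> and \<open>Lambda3\<close> depend on \<open>T\<close>
    only through \<open>Lambda1\<close>, and \<open>Lambda4\<close> only on the input.\<close>
  from Lambda1_alpha[OF assms(1) this]
  show "lift_V g (alpha H \<xi>) u = lift_V g \<xi> u"
    by (simp add: lift_V_def \<xi> u)
qed

end
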